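(* Let $G$ be a connected graph with vertex set $\{x_1,\ldots,x_n\}$, let $v_1,\ldots,v_q$ be the column vectors of the incidence matrix of $G$, let $K$ be a field, let $R=K[x_1,\ldots,x_n]$ be a polynomial ring over $K$, and let $I=I(G)\subset R$ be the edge ideal of $G$. Then there is an isomorphism of $K$-algebras $$R[It,t^{-1}]\simeq K[t,x_1t,\ldots,x_nt,x^{v_1}t,\ldots,x^{v_q}t],$$ where the right-hand side is a subring of $R[t]$.
   Context: Graphs are finite and simple, and have no isolated vertices (each vertex occurs in at least one edge). If $f_1,\ldots,f_q$ are the edges of $G$, the characteristic vector of $f_k$ is $v_k=\sum_{x_i\in f_k}e_i$, where $e_i$ is the $i$-th unit vector in $\mathbb{R}^n$; the incidence matrix of $G$ is the $n\times q$ matrix with columns $v_1,\ldots,v_q$. For $a\in\mathbb{N}^n$, $x^a=x_1^{a_1}\cdots x_n^{a_n}$. The edge ideal $I(G)$ is the ideal of $R$ generated by $x^{v_1},\ldots,x^{v_q}$. The Rees algebra of $I$ is $R[It]=R\oplus It\oplus\cdots\oplus I^it^i\oplus\cdots\subset R[t]$, where $t$ is a new variable, and the extended Rees algebra of $I$ is $R[It,t^{-1}]=R[It][t^{-1}]\subset R[t,t^{-1}]$. *)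

theory Defs
  imports
    "HOL-Analysis.Finite_Cartesian_Product"
    "HOL-Library.Poly_Mapping"
    "HOL-Computational_Algebra.Polynomial"
begin

text \<open>
  A graph is given by its set of edges; the vertices \<open>x\<^sub>1, \<dots>, x\<^sub>n\<close> are the elements of a finite type.
\<close>

definition simple_graph :: "'n::finite set set \<Rightarrow> bool" where
  "simple_graph E \<longleftrightarrow> (\<forall>e\<in>E. card e = 2)"

definition no_isolated_vertices :: "'n::finite set set \<Rightarrow> bool" where
  "no_isolated_vertices E \<longleftrightarrow> (\<forall>x. \<exists>e\<in>E. x \<in> e)"

definition connected_graph :: "'n::finite set set \<Rightarrow> bool" where
  "connected_graph E \<longleftrightarrow> (\<forall>x y. (x, y) \<in> {(a, b). {a, b} \<in> E}\<^sup>*)"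

definition char_vec :: "'n::finite set \<Rightarrow> nat ^ 'n" where
  "char_vec e = (\<Sum>i\<in>e. axis i 1)"

text \<open>The edges are enumerated as \<open>f k\<close>, with \<open>k\<close> ranging over a finite type of column indices.\<close>

definition incidence_matrix :: "('q::finite \<Rightarrow> 'n::finite set) \<Rightarrow> nat ^ 'q ^ 'n" where
  "incidence_matrix f = (\<chi> i k. char_vec (f k) $ i)"


text \<open>
  \<open>K[x\<^sub>1, \<dots>, x\<^sub>n]\<close> is the monoid algebra of the exponent monoid: a polynomial is a finitely
  supported map from exponents to coefficients, multiplied by convolution. In the same way, the
  Laurent polynomials \<open>R[t, t\<^sup>-\<^sup>1]\<close> are the finitely supported maps from \<open>int\<close> to \<open>R\<close>.
\<close>

type_synonym ('n, 'k) mpoly = "('n \<Rightarrow>\<^sub>0 nat) \<Rightarrow>\<^sub>0 'k"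

type_synonym 'r laurent = "int \<Rightarrow>\<^sub>0 'r"

definition mconst :: "'k::comm_ring_1 \<Rightarrow> ('n, 'k) mpoly" where
  "mconst c = Poly_Mapping.single 0 c"

definition mvar :: "'n \<Rightarrow> ('n, 'k::comm_ring_1) mpoly" where
  "mvar i = Poly_Mapping.single (Poly_Mapping.single i 1) 1"

definition mmonom :: "nat ^ 'n::finite \<Rightarrow> ('n, 'k::comm_ring_1) mpoly" where
  "mmonom a = (\<Prod>i\<in>UNIV. mvar i ^ (a $ i))"

definition lconst :: "'r::comm_ring_1 \<Rightarrow> 'r laurent" where
  "lconst r = Poly_Mapping.single 0 r"

definition t_inverse :: "'r::comm_ring_1 laurent" where
  "t_inverse = Poly_Mapping.single (- 1) 1"

text \<open>The inclusion of \<open>R[t]\<close> into \<open>R[t, t\<^sup>-\<^sup>1]\<close>.\<close>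

definition to_laurent :: "'r::comm_ring_1 poly \<Rightarrow> 'r laurent" where
  "to_laurent p = (\<Sum>i\<le>degree p. Poly_Mapping.single (int i) (coeff p i))"


definition subring :: "'r::comm_ring_1 set \<Rightarrow> bool" where
  "subring A \<longleftrightarrow> 1 \<in> A \<and> (\<forall>a\<in>A. \<forall>b\<in>A. a - b \<in> A \<and> a * b \<in> A)"

text \<open>\<open>A[S]\<close> as a subring of the ambient ring.\<close>

definition adjoin :: "'r::comm_ring_1 set \<Rightarrow> 'r set \<Rightarrow> 'r set" where
  "adjoin A S = subring hull (A \<union> S)"

text \<open>The ideals of \<open>R\<close> are the submodules of \<open>R\<close> as a module over itself.\<close>

definition ideal_generated :: "'r::comm_ring_1 set \<Rightarrow> 'r set" where
  "ideal_generated S = module.span (*) S"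

primrec ideal_power :: "'r::comm_ring_1 set \<Rightarrow> nat \<Rightarrow> 'r set" where
  "ideal_power I 0 = UNIV"
| "ideal_power I (Suc i) = ideal_generated {a * b | a b. a \<in> I \<and> b \<in> ideal_power I i}"

definition rees_algebra :: "'r::comm_ring_1 set \<Rightarrow> 'r poly set" where
  "rees_algebra I = {p. \<forall>i. coeff p i \<in> ideal_power I i}"

definition extended_rees_algebra :: "'r::comm_ring_1 set \<Rightarrow> 'r laurent set" where
  "extended_rees_algebra I = adjoin (to_laurent ` rees_algebra I) {t_inverse}"

definition edge_ideal :: "'n::finite set set \<Rightarrow> ('n, 'k::comm_ring_1) mpoly set" where
  "edge_ideal E = ideal_generated ((\<lambda>e. mmonom (char_vec e)) ` E)"


text \<open>
  Isomorphisms of \<open>K\<close>-algebras between subrings \<open>A\<close> and \<open>B\<close>, whose algebra structures are given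
  by ring homomorphisms \<open>\<alpha>\<close> and \<open>\<beta>\<close> from \<open>K\<close>. That units are preserved is the case \<open>c = 1\<close>.
\<close>

definition algebra_iso ::
  "('k::comm_ring_1 \<Rightarrow> 'a::comm_ring_1) \<Rightarrow> 'a set \<Rightarrow> ('k \<Rightarrow> 'b::comm_ring_1) \<Rightarrow> 'b set \<Rightarrow> ('a \<Rightarrow> 'b) \<Rightarrow> bool" where
  "algebra_iso \<alpha> A \<beta> B \<phi> \<longleftrightarrow>
     bij_betw \<phi> A B \<and>
     (\<forall>a\<in>A. \<forall>b\<in>A. \<phi> (a + b) = \<phi> a + \<phi> b \<and> \<phi> (a * b) = \<phi> a * \<phi> b) \<and>
     (\<forall>c. \<phi> (\<alpha> c) = \<beta> c)"

end

theory Submission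
  imports Defs
begin

text \<open>
  The ring \<open>R[t, t\<^sup>-\<^sup>1]\<close> has an involutive automorphism with \<open>x\<^sub>i \<mapsto> x\<^sub>i t\<close> and \<open>t \<mapsto> t\<^sup>-\<^sup>1\<close>; it sends
  \<open>x\<^sup>a t\<^sup>m\<close> to \<open>x\<^sup>a t\<^bsup>|a| - m\<^esup>\<close>. As every edge has exactly two vertices, each \<open>x\<^bsup>v\<^sub>k\<^esup> t\<close> is fixed. Hence
  the generators \<open>x\<^sub>i\<close>, \<open>x\<^bsup>v\<^sub>k\<^esup> t\<close>, \<open>t\<^sup>-\<^sup>1\<close> of the extended Rees algebra are mapped to \<open>x\<^sub>i t\<close>,
  \<open>x\<^bsup>v\<^sub>k\<^esup> t\<close>, \<open>t\<close>.
\<close>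

section \<open>Finitely supported maps\<close>

text \<open>Inserting a fresh key amounts to adding a one-term map, so additive claims need only be
  checked on single terms.\<close>

lemma poly_mapping_sum_induct [case_names zero single add]:
  assumes "P 0" and "\<And>a b. P (Poly_Mapping.single a b)" and "\<And>p q. P p \<Longrightarrow> P q \<Longrightarrow> P (p + q)"
  shows "P (p :: 'a \<Rightarrow>\<^sub>0 'b::comm_monoid_add)"
proof (induction p rule: update_induct)
  case const
  show ?case by (rule assms(1))
next
  case (update f a b)
  have "Poly_Mapping.update a b f = f + Poly_Mapping.single a b"
    using update(1) by (intro poly_mapping_eqI)
      (auto simp: lookup_update lookup_add lookup_single in_keys_iff when_def)
  with update show ?case by (metis assms(2,3))
qed

text \<open>The additive extension of a map given on terms. The coefficient is an argument of
  \<open>g\<close> because it may itself be a polynomial that has to be transformed, as in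
  \<open>flip\<close>.\<close>

definition pm_extend :: "('a \<Rightarrow> 'b::zero \<Rightarrow> 'c::comm_monoid_add) \<Rightarrow> ('a \<Rightarrow>\<^sub>0 'b) \<Rightarrow> 'c" where
  "pm_extend g p = (\<Sum>a\<in>Poly_Mapping.keys p. g a (Poly_Mapping.lookup p a))"

lemma pm_extend_single:
  assumes "\<And>a. g a 0 = 0"
  shows "pm_extend g (Poly_Mapping.single a b) = g a b"
  by (cases "b = 0") (simp_all add: pm_extend_def assms)

lemma pm_extend_zero [simp]: "pm_extend g 0 = 0"
  by (simp add: pm_extend_def)

lemma pm_extend_add:
  fixes p q :: "'a \<Rightarrow>\<^sub>0 'b::comm_monoid_add"
  assumes "\<And>a. g a 0 = 0" and "\<And>a b c. g a (b + c) = g a b + g a c"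
  shows "pm_extend g (p + q) = pm_extend g p + pm_extend g q"
proof -
  let ?S = "Poly_Mapping.keys p \<union> Poly_Mapping.keys q"
  \<comment> \<open>Cancellation can make the support of \<open>p + q\<close> smaller than
    \<open>?S\<close>; since \<open>g a 0 = 0\<close>, all three sums may still be taken over
    \<open>?S\<close>.\<close>
  have ext: "pm_extend g r = (\<Sum>a\<in>?S. g a (Poly_Mapping.lookup r a))"
    if "Poly_Mapping.keys r \<subseteq> ?S" for r
    unfolding pm_extend_def using that
    by (intro sum.mono_neutral_left) (auto simp: in_keys_iff assms(1))
  show ?thesis
    using Poly_Mapping.keys_add[of p q]
    by (simp add: ext lookup_add assms(2) sum.distrib)
qed

text \<open>Both sides are additive in each factor, so two inductions leave a product of two terms,
  where the third assumption is the claim.\<close>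

lemma pm_extend_mult:
  fixes p q :: "'a::comm_monoid_add \<Rightarrow>\<^sub>0 'b::comm_ring_1"
    and g :: "'a \<Rightarrow> 'b \<Rightarrow> 'c::comm_ring_1"
  assumes "\<And>a. g a 0 = 0" and "\<And>a b c. g a (b + c) = g a b + g a c"
    and "\<And>a a' b c. g (a + a') (b * c) = g a b * g a' c"
  shows "pm_extend g (p * q) = pm_extend g p * pm_extend g q"
proof (induction p rule: poly_mapping_sum_induct)
  case (single a b)
  show ?case
    by (induction q rule: poly_mapping_sum_induct)
      (simp_all add: mult_single pm_extend_single pm_extend_add assms distrib_left)
qed (simp_all add: distrib_right pm_extend_add assms(1,2))

section \<open>Polynomials as Laurent polynomials\<close>

lemma lookup_to_laurent:
  "Poly_Mapping.lookup (to_laurent p) m = (if m < 0 then 0 else coeff p (nat m))"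
proof -
  have "Poly_Mapping.lookup (to_laurent p) m = (\<Sum>i\<le>degree p. coeff p i when int i = m)"
    by (simp add: to_laurent_def Poly_Mapping.lookup_sum lookup_single)
  also have "\<dots> = (\<Sum>i\<in>{..degree p} \<inter> {i. int i = m}. coeff p i)"
    by (subst sum.inter_restrict) (auto simp: when_def intro!: sum.cong)
  also have "\<dots> = (if m < 0 then 0 else coeff p (nat m))"
  proof (cases "0 \<le> m \<and> nat m \<le> degree p")
    case True
    then have "{..degree p} \<inter> {i. int i = m} = {nat m}"
      by auto
    with True show ?thesis by simp
  next
    \<comment> \<open>Negative exponents and exponents above the degree: both sides vanish.\<close>
    case False
    then have "{..degree p} \<inter> {i. int i = m} = {}"
      by auto
    with False show ?thesis by (auto simp: coeff_eq_0)
  qed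
  finally show ?thesis .
qed

lemma inj_to_laurent: "inj to_laurent"
proof (rule injI)
  fix p q :: "'a poly"
  assume "to_laurent p = to_laurent q"
  then have "Poly_Mapping.lookup (to_laurent p) (int i) = Poly_Mapping.lookup (to_laurent q) (int i)" for i
    by simp
  then show "p = q"
    by (simp add: lookup_to_laurent poly_eq_iff)
qed

lemma to_laurent_add: "to_laurent (p + q) = to_laurent p + to_laurent q"
  by (rule poly_mapping_eqI) (simp add: lookup_to_laurent lookup_add)

lemma to_laurent_diff: "to_laurent (p - q) = to_laurent p - to_laurent q"
  by (rule poly_mapping_eqI) (simp add: lookup_to_laurent lookup_minus)

lemma to_laurent_monom: "to_laurent (monom c i) = Poly_Mapping.single (int i) c"
  by (rule poly_mapping_eqI) (auto simp: lookup_to_laurent lookup_single when_def)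

lemma to_laurent_const: "to_laurent [:c:] = Poly_Mapping.single 0 c"
  using to_laurent_monom[of c 0] by (simp add: monom_0)

lemma to_laurent_0 [simp]: "to_laurent 0 = 0"
  by (rule poly_mapping_eqI) (simp add: lookup_to_laurent)

lemma to_laurent_1: "to_laurent 1 = 1"
  using to_laurent_const[of 1] by (simp add: one_pCons)

text \<open>Once both factors are expanded into monomials, only exponents have to be added.\<close>

lemma to_laurent_mult: "to_laurent (p * q) = to_laurent p * to_laurent q"
proof -
  have sum: "to_laurent (\<Sum>i\<in>S. h i) = (\<Sum>i\<in>S. to_laurent (h i))" for S :: "'b set" and h :: "'b \<Rightarrow> 'a poly"
    by (induction S rule: infinite_finite_induct) (simp_all add: to_laurent_add)
  have "p * q = (\<Sum>i\<le>degree p. monom (coeff p i) i) * (\<Sum>j\<le>degree q. monom (coeff q j) j)"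
    by (simp only: poly_as_sum_of_monoms)
  also have "\<dots> = (\<Sum>i\<le>degree p. \<Sum>j\<le>degree q. monom (coeff p i * coeff q j) (i + j))"
    by (simp add: sum_product mult_monom)
  finally have "p * q = \<dots>" .
  then show ?thesis
    by (simp add: to_laurent_def[of p] to_laurent_def[of q] sum to_laurent_monom sum_product mult_single)
qed

section \<open>Subrings\<close>

lemma subring_hull: "subring (subring hull S)"
  by (rule hull_in) (auto simp: subring_def)

context
  fixes A :: "'r::comm_ring_1 set"
  assumes A: "subring A"
begin

lemma subring_1: "1 \<in> A"
  and subring_mult: "a \<in> A \<Longrightarrow> b \<in> A \<Longrightarrow> a * b \<in> A"
  and subring_diff: "a \<in> A \<Longrightarrow> b \<in> A \<Longrightarrow> a - b \<in> A"
  using A by (auto simp: subring_def)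

lemma subring_0: "0 \<in> A"
  using subring_diff[OF subring_1 subring_1] by simp

text \<open>\<open>subring\<close> provides differences, hence the form
  \<open>a + b = a - (0 - b)\<close>.\<close>

lemma subring_add: "a \<in> A \<Longrightarrow> b \<in> A \<Longrightarrow> a + b \<in> A"
  using subring_diff[OF _ subring_diff[OF subring_0]] by fastforce

lemma subring_sum: "(\<And>i. i \<in> S \<Longrightarrow> h i \<in> A) \<Longrightarrow> (\<Sum>i\<in>S. h i) \<in> A"
  by (induction S rule: infinite_finite_induct) (auto intro: subring_0 subring_add)

lemma subring_power: "a \<in> A \<Longrightarrow> a ^ n \<in> A"
  by (induction n) (auto intro: subring_1 subring_mult)

lemma subring_prod: "(\<And>i. i \<in> S \<Longrightarrow> h i \<in> A) \<Longrightarrow> (\<Prod>i\<in>S. h i) \<in> A"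
  by (induction S rule: infinite_finite_induct) (auto intro: subring_1 subring_mult)

text \<open>Serves to show that a homomorphism maps a generated subring into \<open>A\<close>: since
  the preimage is a subring, it suffices that it contains the generators.\<close>

lemma subring_vimage:
  assumes "h 1 = 1" and "\<And>a b. h (a - b) = h a - h b" and "\<And>a b. h (a * b) = h a * h b"
  shows "subring (h -` A)"
  using A by (simp add: subring_def assms)

lemma adjoin_subset: "B \<subseteq> A \<Longrightarrow> S \<subseteq> A \<Longrightarrow> adjoin B S \<subseteq> A"
  unfolding adjoin_def by (rule hull_minimal) (use A in auto)

end

lemma subring_adjoin: "subring (adjoin B S)"
  unfolding adjoin_def by (rule subring_hull)

lemma adjoin_superset: "B \<subseteq> adjoin B S" "S \<subseteq> adjoin B S"
  using hull_subset[of "B \<union> S" subring] by (auto simp: adjoin_def)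

lemma subring_image:
  assumes "subring A" "h 1 = 1" and "\<And>a b. h (a - b) = h a - h b" and "\<And>a b. h (a * b) = h a * h b"
  shows "subring (h ` A)"
  unfolding subring_def
proof (intro conjI ballI)
  show "1 \<in> h ` A"
    using assms(2) subring_1[OF assms(1)] by (metis imageI)
next
  fix a b assume "a \<in> h ` A" "b \<in> h ` A"
  then obtain x y where "x \<in> A" "y \<in> A" "a = h x" "b = h y"
    by blast
  then have "a - b = h (x - y)" "x - y \<in> A" "a * b = h (x * y)" "x * y \<in> A"
    using subring_diff[OF assms(1)] subring_mult[OF assms(1)] by (simp_all add: assms(3,4))
  then show "a - b \<in> h ` A" "a * b \<in> h ` A"
    by blast+
qed

section \<open>Ideals\<close>

lemma module_self: "module ((*) :: 'r::comm_ring_1 \<Rightarrow> 'r \<Rightarrow> 'r)"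
  by unfold_locales (simp_all add: algebra_simps)

lemma ideal_generated_superset: "S \<subseteq> ideal_generated S"
  unfolding ideal_generated_def using module.span_superset[OF module_self] .

lemma ideal_generated_zero: "0 \<in> ideal_generated S"
  unfolding ideal_generated_def by (rule module.span_zero[OF module_self])

lemma ideal_generated_subset:
  assumes "S \<subseteq> J" "0 \<in> J" "\<And>a b. a \<in> J \<Longrightarrow> b \<in> J \<Longrightarrow> a + b \<in> J" "\<And>r a. a \<in> J \<Longrightarrow> r * a \<in> J"
  shows "ideal_generated S \<subseteq> J"
  unfolding ideal_generated_def
  by (rule module.span_minimal[OF module_self]) (use assms in \<open>auto intro!: module.subspaceI[OF module_self]\<close>)

lemma zero_in_ideal_power: "0 \<in> ideal_power J i"
  by (cases i) (simp_all add: ideal_generated_zero)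

lemma ideal_power_1_superset: "J \<subseteq> ideal_power J 1"
proof
  fix a assume "a \<in> J"
  \<comment> \<open>The zeroth power is the whole ring, so \<open>a * 1\<close> is among the
    products that generate the first power.\<close>
  then have "a * 1 \<in> {a * b | a b. a \<in> J \<and> b \<in> ideal_power J 0}"
    by (metis (mono_tags, lifting) UNIV_I ideal_power.simps(1) mem_Collect_eq)
  then have "a * 1 \<in> ideal_power J (Suc 0)"
    unfolding ideal_power.simps(2) by (rule subsetD[OF ideal_generated_superset])
  then show "a \<in> ideal_power J 1"
    by simp
qed

lemma const_in_rees_algebra: "[:c:] \<in> rees_algebra J"
  by (auto simp: rees_algebra_def coeff_pCons zero_in_ideal_power simp del: ideal_power.simps(2) split: nat.splits)

lemma monom_in_rees_algebra: "c \<in> J \<Longrightarrow> monom c 1 \<in> rees_algebra J"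
  using ideal_power_1_superset by (auto simp: rees_algebra_def zero_in_ideal_power)

section \<open>Monomials\<close>

definition mdeg :: "('n::finite \<Rightarrow>\<^sub>0 nat) \<Rightarrow> nat" where
  "mdeg a = (\<Sum>i\<in>UNIV. Poly_Mapping.lookup a i)"

lemma mdeg_0 [simp]: "mdeg 0 = 0"
  by (simp add: mdeg_def)

lemma mdeg_add: "mdeg (a + b) = mdeg a + mdeg b"
  by (simp add: mdeg_def lookup_add sum.distrib)

lemma mdeg_single [simp]: "mdeg (Poly_Mapping.single i k) = k"
  by (simp add: mdeg_def lookup_single when_def)

lemma mvar_power: "mvar i ^ k = Poly_Mapping.single (Poly_Mapping.single i k) 1"
  by (induction k) (simp_all add: mvar_def mult_single single_add[symmetric])

lemma prod_single_1:
  "(\<Prod>i\<in>S. Poly_Mapping.single (h i) (1::'b::comm_ring_1)) = Poly_Mapping.single (\<Sum>i\<in>S. h i :: 'a::comm_monoid_add) 1"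
  by (induction S rule: infinite_finite_induct) (simp_all add: mult_single)

lemma prod_mvar_power:
  "(\<Prod>i\<in>UNIV. mvar i ^ k i) = Poly_Mapping.single (\<Sum>i\<in>UNIV. Poly_Mapping.single (i::'n::finite) (k i)) 1"
  by (simp add: mvar_power prod_single_1)

lemma sum_single_lookup:
  "(\<Sum>i\<in>UNIV. Poly_Mapping.single (i::'n::finite) (Poly_Mapping.lookup a i)) = a"
  by (rule poly_mapping_eqI) (simp add: Poly_Mapping.lookup_sum lookup_single when_def)

lemma mdeg_sum_single: "mdeg (\<Sum>i\<in>UNIV. Poly_Mapping.single (i::'n::finite) (k i)) = (\<Sum>i\<in>UNIV. k i)"
  by (simp add: mdeg_def Poly_Mapping.lookup_sum lookup_single when_def)

text \<open>The involution only needs to know that a monomial is one term with coefficient 1 and a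
  given degree, so the exponent \<open>b\<close> stays abstract.\<close>

lemma mmonom_eq_single:
  obtains b where "mmonom a = Poly_Mapping.single b 1" and "mdeg b = (\<Sum>i\<in>UNIV. a $ i)"
  by (rule that[of "\<Sum>i\<in>UNIV. Poly_Mapping.single i (a $ i)"])
    (simp_all only: mmonom_def prod_mvar_power mdeg_sum_single)

lemma sum_char_vec: "(\<Sum>i\<in>UNIV. char_vec e $ i) = card e"
proof -
  have "char_vec e $ i = (if i \<in> e then 1 else 0)" for i
    by (simp add: char_vec_def axis_def)
  then show ?thesis
    by (simp add: sum.If_cases)
qed

text \<open>Every term is a constant times a product of powers of variables, and every polynomial is
  a sum of terms.\<close>

lemma subring_mpoly_eq_UNIV:
  fixes S :: "('n::finite, 'k::comm_ring_1) mpoly set"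
  assumes S: "subring S" and "\<And>c. mconst c \<in> S" and "\<And>i. mvar i \<in> S"
  shows "S = UNIV"
proof -
  have "p \<in> S" for p
  proof (induction p rule: poly_mapping_sum_induct)
    case (single a c)
    have "Poly_Mapping.single a c = mconst c * (\<Prod>i\<in>UNIV. mvar i ^ Poly_Mapping.lookup a i)"
      by (simp add: mconst_def prod_mvar_power sum_single_lookup mult_single)
    then show ?case
      by (auto intro!: subring_mult subring_prod subring_power S assms(2,3))
  qed (auto intro: subring_0 subring_add S)
  then show ?thesis by blast
qed

section \<open>The involution\<close>

text \<open>The substitution \<open>x_i\<close> \<mapsto> \<open>x_i t\<close>; the coefficient of
  \<open>t^d\<close> in the result is the homogeneous component of degree \<open>d\<close>.\<close>

definition hom_coeff :: "('n::finite, 'k::comm_ring_1) mpoly \<Rightarrow> ('n, 'k) mpoly laurent" where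
  "hom_coeff = pm_extend (\<lambda>a c. Poly_Mapping.single (int (mdeg a)) (Poly_Mapping.single a c))"

text \<open>Since \<open>Poly_Mapping.single (- m) 1\<close> is \<open>t^(-m)\<close>, this inverts
  \<open>t\<close> and substitutes \<open>x_i t\<close> for \<open>x_i\<close> in the
  coefficients.\<close>

definition flip :: "('n::finite, 'k::comm_ring_1) mpoly laurent \<Rightarrow> ('n, 'k) mpoly laurent" where
  "flip = pm_extend (\<lambda>m r. Poly_Mapping.single (- m) 1 * hom_coeff r)"

lemma hom_coeff_0 [simp]: "hom_coeff 0 = 0"
  by (simp add: hom_coeff_def)

lemma hom_coeff_single:
  "hom_coeff (Poly_Mapping.single a c) = Poly_Mapping.single (int (mdeg a)) (Poly_Mapping.single a c)"
  by (simp add: hom_coeff_def pm_extend_single)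

lemma hom_coeff_add: "hom_coeff (p + q) = hom_coeff p + hom_coeff q"
  unfolding hom_coeff_def by (rule pm_extend_add) (simp_all add: single_add)

lemma hom_coeff_mult: "hom_coeff (p * q) = hom_coeff p * hom_coeff q"
  unfolding hom_coeff_def by (rule pm_extend_mult) (simp_all add: single_add mult_single mdeg_add)

lemma flip_add: "flip (P + Q) = flip P + flip Q"
  unfolding flip_def by (rule pm_extend_add) (simp_all add: hom_coeff_add distrib_left)

lemma flip_mult: "flip (P * Q) = flip P * flip Q"
  unfolding flip_def
proof (rule pm_extend_mult)
  fix m n :: int and r s :: "('a, 'b) mpoly"
  have "Poly_Mapping.single (- (m + n)) (1 :: ('a, 'b) mpoly) = Poly_Mapping.single (- m) 1 * Poly_Mapping.single (- n) 1"
    by (simp add: mult_single)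
  then show "Poly_Mapping.single (- (m + n)) 1 * hom_coeff (r * s) =
      Poly_Mapping.single (- m) 1 * hom_coeff r * (Poly_Mapping.single (- n) 1 * hom_coeff s)"
    by (simp only: hom_coeff_mult mult_ac)
qed (simp_all add: hom_coeff_add distrib_left)

lemma flip_0 [simp]: "flip 0 = 0"
  by (simp add: flip_def)

lemma flip_single:
  "flip (Poly_Mapping.single m (Poly_Mapping.single a c)) =
    Poly_Mapping.single (int (mdeg a) - m) (Poly_Mapping.single a c)"
  by (simp add: flip_def pm_extend_single hom_coeff_single mult_single)

lemma flip_single_1: "flip (Poly_Mapping.single m 1) = Poly_Mapping.single (- m) 1"
  using flip_single[of m 0 1] by simp

lemma flip_1: "flip 1 = 1"
  using flip_single_1[of 0] by simp

lemma flip_diff: "flip (P - Q) = flip P - flip Q"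
  using flip_add[of "P - Q" Q] by (simp add: algebra_simps)

text \<open>On \<open>x^a t^m\<close> the exponent of \<open>t\<close> becomes
  \<open>|a| - (|a| - m) = m\<close>. The inner induction is there because a coefficient
  \<open>r\<close> is itself a sum of terms.\<close>

lemma flip_flip: "flip (flip P) = P"
proof (induction P rule: poly_mapping_sum_induct)
  case (single m r)
  show ?case
    by (induction r rule: poly_mapping_sum_induct) (simp_all add: flip_single single_add flip_add)
qed (simp_all add: flip_add)

lemma flip_mconst: "flip (Poly_Mapping.single 0 (mconst c)) = Poly_Mapping.single 0 (mconst c)"
  by (simp add: mconst_def flip_single)

lemma flip_mvar: "flip (Poly_Mapping.single m (mvar i)) = Poly_Mapping.single (1 - m) (mvar i)"
  by (simp add: mvar_def flip_single)

text \<open>The monomial has degree 2, so the exponent of \<open>t\<close> goes from 1 to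
  \<open>2 - 1 = 1\<close>.\<close>

lemma flip_edge:
  assumes "card e = 2"
  shows "flip (Poly_Mapping.single 1 (mmonom (char_vec e))) = Poly_Mapping.single 1 (mmonom (char_vec e))"
proof -
  obtain b where "mmonom (char_vec e) = Poly_Mapping.single b (1 :: 'b)" "mdeg b = card e"
    by (metis mmonom_eq_single sum_char_vec)
  with assms show ?thesis
    by (simp add: flip_single)
qed

section \<open>Generators of the extended Rees algebra\<close>

text \<open>Reduces containment of the extended Rees algebra in \<open>A\<close> to its generators:
  the coefficient ring, the elements \<open>a t\<close> with \<open>a\<close> in \<open>G\<close>,
  and the inverse of \<open>t\<close>.\<close>

lemma extended_rees_algebra_subset:
  fixes G :: "'r::comm_ring_1 set"
  assumes A: "subring A" and const: "\<And>r. Poly_Mapping.single 0 r \<in> A"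
    and gen: "\<And>a. a \<in> G \<Longrightarrow> Poly_Mapping.single 1 a \<in> A" and "t_inverse \<in> A"
  shows "extended_rees_algebra (ideal_generated G) \<subseteq> A"
proof -
  \<comment> \<open>As \<open>A\<close> contains all coefficients, the elements \<open>a\<close>
    with \<open>a t^i\<close> in \<open>A\<close> form an ideal, for each fixed
    \<open>i\<close>.\<close>
  have ideal: "ideal_generated S \<subseteq> {a. Poly_Mapping.single i a \<in> A}"
    if "\<And>a. a \<in> S \<Longrightarrow> Poly_Mapping.single i a \<in> A" for S i
  proof (rule ideal_generated_subset)
    fix r a assume "a \<in> {a. Poly_Mapping.single i a \<in> A}"
    then show "r * a \<in> {a. Poly_Mapping.single i a \<in> A}"
      using subring_mult[OF A const, of "Poly_Mapping.single i a" r] by (simp add: mult_single)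
  qed (use that subring_0[OF A] subring_add[OF A] in \<open>auto simp: single_add\<close>)
  have power: "Poly_Mapping.single (int i) a \<in> A" if "a \<in> ideal_power (ideal_generated G) i" for i a
    using that
  proof (induction i arbitrary: a)
    case 0
    then show ?case using const by simp
  next
    case (Suc i)
    \<comment> \<open>Factor \<open>b c t^(i+1)\<close> as \<open>(b t) (c t^i)\<close>.\<close>
    have "Poly_Mapping.single (int (Suc i)) (b * c) \<in> A"
      if "b \<in> ideal_generated G" "c \<in> ideal_power (ideal_generated G) i" for b c
    proof -
      have "Poly_Mapping.single 1 b \<in> A"
        using ideal[of G 1] gen that(1) by blast
      from subring_mult[OF A this Suc.IH[OF that(2)]] show ?thesis
        by (simp add: mult_single)
    qed
    then have "ideal_power (ideal_generated G) (Suc i) \<subseteq> {a. Poly_Mapping.single (int (Suc i)) a \<in> A}"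
      unfolding ideal_power.simps by (intro ideal) blast
    with Suc.prems show ?case by blast
  qed
  have "to_laurent p \<in> A" if "p \<in> rees_algebra (ideal_generated G)" for p
    unfolding to_laurent_def using that by (intro subring_sum[OF A] power) (simp add: rees_algebra_def)
  then show ?thesis
    unfolding extended_rees_algebra_def using assms(4) by (intro adjoin_subset[OF A]) auto
qed

section \<open>The involution exchanges the two subrings\<close>

theorem proposition3p1:
  fixes E :: "'n::finite set set"
    and f :: "'q::finite \<Rightarrow> 'n set"
    and v :: "'q \<Rightarrow> nat ^ 'n"
    and I :: "('n, 'k::field) mpoly set"
  assumes "simple_graph E"
    and "no_isolated_vertices E"
    and "connected_graph E"
    and "bij_betw f UNIV E"
    and "v = (\<lambda>k. column k (incidence_matrix f))"
    and "I = edge_ideal E"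
  shows "\<exists>\<phi>. algebra_iso
           (\<lambda>c::'k. lconst (mconst c))
           (extended_rees_algebra I)
           (\<lambda>c. [:mconst c:])
           (adjoin (range (\<lambda>c. [:mconst c:]))
              ({monom 1 1} \<union> range (\<lambda>i. monom (mvar i) 1) \<union> range (\<lambda>k. monom (mmonom (v k)) 1)))
           \<phi>"
proof -
  define C where "C = range (\<lambda>c::'k. [:mconst c :: ('n, 'k) mpoly:])"
  define G where "G = {monom 1 1} \<union> range (\<lambda>i. monom (mvar i) 1) \<union>
    range (\<lambda>k. monom (mmonom (v k) :: ('n, 'k) mpoly) 1)"
  define B where "B = adjoin C G"
  define A where "A = extended_rees_algebra I"
  have v: "v k = char_vec (f k)" for k
    by (simp add: assms(5) column_def incidence_matrix_def)
  have E: "E = range f"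
    using assms(4) by (simp add: bij_betw_def)
  have card: "card (f k) = 2" for k
    using assms(1) by (simp add: E simple_graph_def)
  have I: "I = ideal_generated (range (\<lambda>k. mmonom (v k)))"
    by (simp add: assms(6) edge_ideal_def E image_image v)
  have fix_edge: "flip (Poly_Mapping.single 1 (mmonom (v k))) = Poly_Mapping.single 1 (mmonom (v k) :: ('n, 'k) mpoly)" for k
    unfolding v by (rule flip_edge[OF card])

  \<comment> \<open>The involution acts on Laurent polynomials, whereas \<open>B\<close> lies in
    \<open>R[t]\<close>; hence \<open>B\<close> is replaced by its image there.\<close>
  have subring_B: "subring (to_laurent ` B)"
    unfolding B_def
    by (rule subring_image[where h = to_laurent, OF subring_adjoin to_laurent_1 to_laurent_diff to_laurent_mult])
  have B_const: "lconst (mconst c) \<in> to_laurent ` B" for c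
  proof -
    have "[:mconst c:] \<in> B"
      unfolding B_def using adjoin_superset(1)[of C G] by (auto simp: C_def)
    then show ?thesis
      unfolding lconst_def using to_laurent_const[of "mconst c"] by (metis imageI)
  qed
  have B_gen: "Poly_Mapping.single 1 c \<in> to_laurent ` B"
    if "c = 1 \<or> (\<exists>i. c = mvar i) \<or> (\<exists>k. c = mmonom (v k))" for c
  proof -
    have "monom c 1 \<in> B"
      unfolding B_def using that adjoin_superset(2)[of G C] by (auto simp: G_def)
    then show ?thesis
      using to_laurent_monom[of c 1] by (metis imageI of_nat_1)
  qed
  have flip_A: "flip P \<in> to_laurent ` B" if "P \<in> A" for P
  proof -
    have pre: "subring (flip -` to_laurent ` B)"
      by (rule subring_vimage[where h = flip, OF subring_B flip_1 flip_diff flip_mult])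
    have "A \<subseteq> flip -` to_laurent ` B"
      unfolding A_def I
    proof (rule extended_rees_algebra_subset[OF pre])
      \<comment> \<open>Pulling back once more, along the inclusion of the coefficient ring, leaves
        only constants, which are fixed, and variables, which go to \<open>x_i t\<close>.\<close>
      have "subring (Poly_Mapping.single 0 -` flip -` to_laurent ` B)"
        by (rule subring_vimage[where h = "Poly_Mapping.single 0", OF pre]) (simp_all add: single_diff mult_single)
      then have "Poly_Mapping.single 0 -` flip -` to_laurent ` B = UNIV"
      proof (rule subring_mpoly_eq_UNIV)
        show "mconst c \<in> Poly_Mapping.single 0 -` flip -` to_laurent ` B" for c
          using B_const[of c] by (simp add: flip_mconst lconst_def)
        show "mvar i \<in> Poly_Mapping.single 0 -` flip -` to_laurent ` B" for i
          using B_gen[of "mvar i"] by (auto simp: flip_mvar)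
      qed
      then show "Poly_Mapping.single 0 r \<in> flip -` to_laurent ` B" for r
        by blast
      show "Poly_Mapping.single 1 a \<in> flip -` to_laurent ` B" if "a \<in> range (\<lambda>k. mmonom (v k))" for a
        using that by (auto simp: fix_edge intro!: B_gen)
      show "t_inverse \<in> flip -` to_laurent ` B"
        using B_gen[of 1] by (simp add: t_inverse_def flip_single_1)
    qed
    with that show ?thesis by auto
  qed

  have subring_A: "subring A"
    unfolding A_def extended_rees_algebra_def by (rule subring_adjoin)
  have rees: "to_laurent p \<in> A" if "p \<in> rees_algebra I" for p
    unfolding A_def extended_rees_algebra_def using that by (intro subsetD[OF adjoin_superset(1)] imageI)
  have A_const: "Poly_Mapping.single 0 r \<in> A" for r
    using rees[OF const_in_rees_algebra] by (simp add: to_laurent_const)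
  have t_inv: "t_inverse \<in> A"
    unfolding A_def extended_rees_algebra_def by (rule subsetD[OF adjoin_superset(2)]) simp
  \<comment> \<open>The converse inclusion, again on generators: \<open>t\<close> goes to its
    inverse, \<open>x_i t\<close> to the element \<open>x_i\<close> of the coefficient ring, and the
    edge generators are fixed and lie in degree one of the Rees algebra.\<close>
  have flip_B: "flip (to_laurent p) \<in> A" if "p \<in> B" for p
  proof -
    have "subring ((\<lambda>p. flip (to_laurent p)) -` A)"
      by (rule subring_vimage[where h = "\<lambda>p. flip (to_laurent p)", OF subring_A])
        (simp_all add: to_laurent_1 to_laurent_diff to_laurent_mult flip_1 flip_diff flip_mult)
    then have "B \<subseteq> (\<lambda>p. flip (to_laurent p)) -` A"
      unfolding B_def
    proof (rule adjoin_subset)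
      show "C \<subseteq> (\<lambda>p. flip (to_laurent p)) -` A"
        using A_const by (auto simp: C_def to_laurent_const flip_mconst)
      have "flip (to_laurent (monom 1 1)) \<in> A"
        using t_inv by (simp add: to_laurent_monom flip_single_1 t_inverse_def)
      moreover have "flip (to_laurent (monom (mvar i) 1)) \<in> A" for i
        using A_const by (simp add: to_laurent_monom flip_mvar)
      moreover have "flip (to_laurent (monom (mmonom (v k)) 1)) \<in> A" for k
      proof -
        have "to_laurent (monom (mmonom (v k)) 1) \<in> A"
          by (intro rees monom_in_rees_algebra) (unfold I, rule subsetD[OF ideal_generated_superset], rule rangeI)
        then show ?thesis
          by (simp add: to_laurent_monom fix_edge)
      qed
      ultimately show "G \<subseteq> (\<lambda>p. flip (to_laurent p)) -` A"
        by (auto simp: G_def)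
    qed
    with that show ?thesis by auto
  qed

  \<comment> \<open>By \<open>flip_A\<close>, the inverse of the injective \<open>to_laurent\<close>
    is applied on its range whenever \<open>P\<close> lies in \<open>A\<close>; elsewhere the value
    of \<open>inv\<close> is arbitrary.\<close>
  define \<phi> where "\<phi> P = inv to_laurent (flip P)" for P :: "('n, 'k) mpoly laurent"
  have \<phi>: "\<phi> P = p" if "flip P = to_laurent p" for P p
    using that by (simp add: \<phi>_def inv_f_f[OF inj_to_laurent])
  have to_\<phi>: "to_laurent (\<phi> P) = flip P" "\<phi> P \<in> B" if "P \<in> A" for P
    using flip_A[OF that] \<phi> by auto
  \<comment> \<open>Because \<open>flip\<close> is an involution, the inverse map is
    \<open>flip\<close> after \<open>to_laurent\<close>.\<close>
  have "bij_betw \<phi> A B"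
    by (rule bij_betw_byWitness[where f' = "\<lambda>p. flip (to_laurent p)"])
      (use to_\<phi> flip_B in \<open>auto simp: flip_flip intro: \<phi>\<close>)
  \<comment> \<open>By the fact \<open>\<phi>\<close>, it suffices to compare both sides after
    \<open>to_laurent\<close>, where \<open>flip\<close> is a homomorphism.\<close>
  moreover have "\<phi> (P + Q) = \<phi> P + \<phi> Q" "\<phi> (P * Q) = \<phi> P * \<phi> Q" if "P \<in> A" "Q \<in> A" for P Q
    using that by (auto intro!: \<phi> simp: to_laurent_add to_laurent_mult flip_add flip_mult to_\<phi>)
  moreover have "\<phi> (lconst (mconst c)) = [:mconst c:]" for c
    by (rule \<phi>) (simp add: flip_mconst to_laurent_const lconst_def)
  ultimately show ?thesis
    unfolding algebra_iso_def A_def B_def C_def G_def by blast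
qed

end
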